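(* Let $\mathbf{Q}^{\pm}(t)$ be differentiable-in-time grid functions solving the semi-discrete approximation with weakly enforced interface conditions $$\widetilde{\mathbf{P}}^{-1}\frac{d}{dt}\mathbf{Q}=\sum_{\xi\in\{q,r,s\}}(I_9\otimes\mathbf{D}_{-\xi})\mathbf{F}_\xi(\mathbf{Q})+\sum_{\xi\in\{q,r,s\}}\mathbf{B}_\xi\left(\nabla_{D_+}\mathbf{Q}\right)+\mathbf{SAT}_q,\qquad \mathbf{Q}\in\{\mathbf{Q}^-,\mathbf{Q}^+\},$$ where all operators, the penalty terms $\mathbf{SAT}_q=\mathbf{SAT}_q^{\pm}$, and the hat-variables are as defined in the context, and where boundary contributions from all faces other than the fault are zero. Then $$\frac{d}{dt}\left(\|\mathbf{Q}^-(t)\|_{HP}^2+\|\mathbf{Q}^+(t)\|_{HP}^2\right)=F_{luc}(\mathbf{G}^-,\mathbf{Z}^-)+F_{luc}(\mathbf{G}^+,\mathbf{Z}^+)+\mathbb{IT}_s\le 0,$$ where $$F_{luc}(\mathbf{G}^{\pm},\mathbf{Z}^{\pm})=-\mathbb{I}_q\left(\sum_{j\in\{l,m,n\}}\frac{1}{Z_j^{\pm}}|G_j^{\pm}|^2\right)\le 0,\qquad \mathbb{IT}_s=-\mathbb{I}_q\left(\widehat\alpha\,|\widehat V|^2\right)\le 0 .$$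
   Context: **Geometry.** Two elastic blocks $\Omega^-,\Omega^+$ share a fault interface $\Gamma_F$. Each block is the image of the unit cube $[0,1]^3$ with coordinates $(q,r,s)$ under a smooth invertible map to $(x,y,z)$ with Jacobian determinant $J>0$; $\xi_x,\xi_y,\xi_z$ denote the partial derivatives of $\xi\in\{q,r,s\}$ with respect to $x,y,z$. The fault is the face $q=1$ of the $-$ block and the face $q=0$ of the $+$ block; the two parametrizations (and grids) agree there, so the unit normal $\mathbf n=(n_x,n_y,n_z)^T=(q_x,q_y,q_z)^T/|\mathbf q_\xi|$, $|\mathbf q_\xi|=\sqrt{q_x^2+q_y^2+q_z^2}$, and the factor $J|\mathbf q_\xi|$ are the same from both sides. **Fields.** In each block $\mathbf Q=(v_x,v_y,v_z,\sigma_{xx},\sigma_{yy},\sigma_{zz},\sigma_{xy},\sigma_{xz},\sigma_{yz})^T$ at every grid point. $\widetilde{\mathbf P}^{-1}=J\mathbf P^{-1}$ with $\mathbf P=\mathrm{diag}(\rho^{-1}I_3,\mathbf C)$, $\rho>0$ the density, $\mathbf C$ the symmetric positive definite $6\times6$ stiffness matrix (both time-independent, possibly varying in space and between blocks). Pointwise, $\mathbf F_\xi(\mathbf Q)=\big(J(\xi_x\sigma_{xx}+\xi_y\sigma_{xy}+\xi_z\sigma_{xz}),\,J(\xi_x\sigma_{xy}+\xi_y\sigma_{yy}+\xi_z\sigma_{yz}),\,J(\xi_x\sigma_{xz}+\xi_y\sigma_{yz}+\xi_z\sigma_{zz}),0,0,0,0,0,0\big)^T$, and $\mathbf B_\xi(\nabla_{D_+}\mathbf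 Q)=J\big(0,0,0,\ \xi_xd_x,\ \xi_yd_y,\ \xi_zd_z,\ \xi_yd_x+\xi_xd_y,\ \xi_zd_x+\xi_xd_z,\ \xi_zd_y+\xi_yd_z\big)^T$ with $d_a=\mathbf D_{+\xi}v_a$ for $a\in\{x,y,z\}$. **Dual-pairing (DP) SBP operators.** For each $\xi\in\{q,r,s\}$ the grid is $\xi_i=i/n_\xi$, $i=0,\dots,n_\xi$. $H_\xi=\mathrm{diag}(h_0^{(\xi)},\dots,h_{n_\xi}^{(\xi)})$ with all $h_i^{(\xi)}>0$, and $D_{+\xi},D_{-\xi}$ are linear maps on $\mathbb R^{n_\xi+1}$ with $(D_{+\xi}\mathbf f)^TH_\xi\mathbf g+\mathbf f^TH_\xi(D_{-\xi}\mathbf g)=f_{n_\xi}g_{n_\xi}-f_0g_0$ for all $\mathbf f,\mathbf g$. $\mathbf D_{\pm\xi}$ is the tensor-product extension to 3D grid functions acting in direction $\xi$ (identity in the other directions), and $\mathbf H=H_q\otimes H_r\otimes H_s$. The inner product is $\langle\mathbf g,\mathbf f\rangle_{\mathbf H}=\mathbf g^T\mathbf H\mathbf f$ (summed over the 9 components for vector fields), and the energy norm is $\|\mathbf Q\|_{HP}^2=\langle\mathbf Q,\tfrac12\widetilde{\mathbf P}^{-1}\mathbf Q\rangle_{\mathbf H}$. For a grid function $g_{jk}$ on the fault, $\mathbb I_q(g)=\sum_{j=0}^{n_r}\sum_{k=0}^{n_s}J_{jk}|\mathbf q_\xi|_{jk}\,g_{jk}\,h_j^{(r)}h_k^{(s)}$.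 **Interface variables.** At each fault grid point, $\mathbf v^{\pm}=(v_x,v_y,v_z)^T$ and $\mathbf T^{\pm}=\bar{\bar\sigma}\mathbf n$ ($\bar{\bar\sigma}$ the symmetric $3\times 3$ stress matrix) are taken from the $\pm$ block at its fault face. With a local orthonormal basis $\mathbf n,\mathbf m,\mathbf l$ and $\mathbf R$ the matrix with rows $\mathbf n^T,\mathbf m^T,\mathbf l^T$, let $(v_n^\pm,v_m^\pm,v_l^\pm)^T=\mathbf R\mathbf v^\pm$, $(T_n^\pm,T_m^\pm,T_l^\pm)^T=\mathbf R\mathbf T^\pm$. Given $Z_j^\pm>0$, the hat-variables $\widehat v_j^\pm$, $\widehat T_j^\pm=\widehat T_j$, $j\in\{l,m,n\}$, satisfy (at every fault grid point and time): $Z_j^+\widehat v_j^++\widehat T_j=Z_j^+v_j^++T_j^+$; $Z_j^-\widehat v_j^--\widehat T_j=Z_j^-v_j^--T_j^-$ $(j\in\{l,m,n\})$; $[\![\widehat v_n]\!]=0$; $\widehat T_j=\widehat\alpha[\![\widehat v_j]\!]$ $(j\in\{l,m\})$, where $[\![\widehat v_j]\!]=\widehat v_j^+-\widehat v_j^-$, $\widehat V=([\![\widehat v_l]\!]^2+[\![\widehat v_m]\!]^2)^{1/2}$, $\widehat\alpha=\widehat\sigma_nf(\widehat V,\psi)/\widehat V\ge0$, $\widehat\sigma_n=-\widehat T_n>0$, and $f\ge0$ is the friction coefficient, $\psi$ a state variable (at points with $\widehat V=0$, $\widehat\alpha$ is some finite nonnegative number). **Penalty terms.** $G_j^+=\tfrac12Z_j^+(v_j^+-\widehat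 v_j^+)-\tfrac12(T_j^+-\widehat T_j^+)$, $G_j^-=\tfrac12Z_j^-(v_j^--\widehat v_j^-)+\tfrac12(T_j^--\widehat T_j^-)$, $\widetilde G_j^\pm=G_j^\pm/Z_j^\pm$; $(G_x,G_y,G_z)^T=\mathbf R^T(G_n,G_m,G_l)^T$ and likewise for $\widetilde G$. Let $\mathbf{SAT}^{\pm}=\big(G_x,G_y,G_z,\ \mp n_x\widetilde G_x,\ \mp n_y\widetilde G_y,\ \mp n_z\widetilde G_z,\ \mp(n_y\widetilde G_x+n_x\widetilde G_y),\ \mp(n_z\widetilde G_x+n_x\widetilde G_z),\ \mp(n_z\widetilde G_y+n_y\widetilde G_z)\big)^T$ with all $G,\widetilde G$ carrying the superscript $\pm$. $\mathbf{SAT}_q^-$ is the grid function supported on the face $i=n_q$ of the $-$ block with value $-\frac{1}{h_{n_q}^{(q)}}J|\mathbf q_\xi|\,\mathbf{SAT}^-$ there, and $\mathbf{SAT}_q^+$ is supported on the face $i=0$ of the $+$ block with value $-\frac{1}{h_0^{(q)}}J|\mathbf q_\xi|\,\mathbf{SAT}^+$ there. **Other boundaries.** When SBP is applied in the expansion of $\langle\mathbf Q,\sum_\xi(I_9\otimes\mathbf D_{-\xi})\mathbf F_\xi(\mathbf Q)\rangle_{\mathbf H}$, the discrete boundary terms $\mathbf Q^T\mathbf F_\xi(\mathbf Q)$, summed with the quadrature weights over each face other than the fault, are assumed to be zero. *)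

theory Defs
  imports "HOL-Analysis.Analysis"
begin

(* Conventions for the index type 3: physical components x, y, z are 1, 2, 3; reference
   directions q, r, s are 1, 2, 3; fault-local components n, m, l are 1, 2, 3.
   Stress vectors in real^6 are ordered (xx, yy, zz, xy, xz, yz), and the nine unknowns at a
   grid point are kept as the pair (velocity, stress); the inner product of the product space
   is the sum over all nine components. *)

type_synonym gidx = "3 \<Rightarrow> nat"
type_synonym state = "(real^3) \<times> (real^6)"

datatype side = Minus | Plus

primrec sg :: "side \<Rightarrow> real" where
  "sg Plus = 1"
| "sg Minus = -1"

subsection \<open>Smooth maps\<close>

(* Only meant for open sets S. *)
primrec Ck_on :: "nat \<Rightarrow> ('a::real_normed_vector \<Rightarrow> 'b::real_normed_vector) \<Rightarrow> 'a set \<Rightarrow> bool" where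
  "Ck_on 0 f S \<longleftrightarrow> continuous_on S f"
| "Ck_on (Suc k) f S \<longleftrightarrow>
     (\<forall>x\<in>S. f differentiable (at x)) \<and> (\<forall>v. Ck_on k (\<lambda>x. frechet_derivative f (at x) v) S)"

definition smooth_on :: "('a::real_normed_vector \<Rightarrow> 'b::real_normed_vector) \<Rightarrow> 'a set \<Rightarrow> bool" where
  "smooth_on f S \<longleftrightarrow> (\<forall>k. Ck_on k f S)"

definition unit_cube :: "(real^3) set" where
  "unit_cube = cbox 0 1"

(* Smoothness on the closed cube means smoothness on some open neighbourhood; a smooth map that
   is injective on the compact cube with J > 0 there is a diffeomorphism of a neighbourhood. *)
definition smooth_coords :: "(real^3 \<Rightarrow> real^3) \<Rightarrow> (real^3 \<Rightarrow> real^3) \<Rightarrow> bool" where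
  "smooth_coords \<phi> \<gamma> \<longleftrightarrow>
     (\<exists>U W. open U \<and> open W \<and> unit_cube \<subseteq> U \<and> smooth_on \<phi> U \<and> smooth_on \<gamma> W
        \<and> \<phi> ` U = W \<and> (\<forall>u\<in>U. \<gamma> (\<phi> u) = u))
     \<and> (\<forall>u\<in>unit_cube. 0 < det (matrix (frechet_derivative \<phi> (at u))))"

subsection \<open>Discrete setting\<close>

(* npts: the numbers n of the grids 0..n;  emb: the map (q,r,s) -> (x,y,z) of a block;
   coord: its inverse;  tan_m, tan_l: fault tangents;  imp: the coefficients Z in local
   components (n, m, l);  fric: friction coefficient as a function of slip rate and state.
   The matrices Dp, Dm represent the difference operators of each direction; the grids and
   operators are the same in both blocks. *)
record setting =
  npts :: "3 \<Rightarrow> nat"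
  wt :: "3 \<Rightarrow> nat \<Rightarrow> real"
  Dp :: "3 \<Rightarrow> nat \<Rightarrow> nat \<Rightarrow> real"
  Dm :: "3 \<Rightarrow> nat \<Rightarrow> nat \<Rightarrow> real"
  emb :: "side \<Rightarrow> real^3 \<Rightarrow> real^3"
  coord :: "side \<Rightarrow> real^3 \<Rightarrow> real^3"
  dens :: "side \<Rightarrow> gidx \<Rightarrow> real"
  stiff :: "side \<Rightarrow> gidx \<Rightarrow> real^6^6"
  tan_m :: "nat \<Rightarrow> nat \<Rightarrow> real^3"
  tan_l :: "nat \<Rightarrow> nat \<Rightarrow> real^3"
  imp :: "side \<Rightarrow> nat \<Rightarrow> nat \<Rightarrow> real^3"
  fric :: "real \<Rightarrow> real \<Rightarrow> real"

definition grid :: "setting \<Rightarrow> gidx set" where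
  "grid M = {p. \<forall>\<xi>. p \<xi> \<le> npts M \<xi>}"

definition node :: "setting \<Rightarrow> gidx \<Rightarrow> real^3" where
  "node M p = (\<chi> \<xi>. real (p \<xi>) / real (npts M \<xi>))"

definition ap1 :: "nat \<Rightarrow> (nat \<Rightarrow> nat \<Rightarrow> real) \<Rightarrow> (nat \<Rightarrow> 'a::real_vector) \<Rightarrow> nat \<Rightarrow> 'a" where
  "ap1 n D f i = (\<Sum>j\<le>n. D i j *\<^sub>R f j)"

definition dp_sbp :: "setting \<Rightarrow> bool" where
  "dp_sbp M \<longleftrightarrow> (\<forall>\<xi>. 0 < npts M \<xi> \<and> (\<forall>i\<le>npts M \<xi>. 0 < wt M \<xi> i)
     \<and> (\<forall>f g. (\<Sum>i\<le>npts M \<xi>. ap1 (npts M \<xi>) (Dp M \<xi>) f i * wt M \<xi> i * g i)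
            + (\<Sum>i\<le>npts M \<xi>. f i * wt M \<xi> i * ap1 (npts M \<xi>) (Dm M \<xi>) g i)
            = f (npts M \<xi>) * g (npts M \<xi>) - f 0 * (g 0 :: real)))"

(* Tensor-product extension: acts in direction xi, identity in the other directions
   (and on the components of vector-valued grid functions). *)
definition tensor_ext :: "setting \<Rightarrow> (3 \<Rightarrow> nat \<Rightarrow> nat \<Rightarrow> real) \<Rightarrow> 3 \<Rightarrow> (gidx \<Rightarrow> 'a::real_vector) \<Rightarrow> gidx \<Rightarrow> 'a" where
  "tensor_ext M D \<xi> f p = ap1 (npts M \<xi>) (D \<xi>) (\<lambda>j. f (p(\<xi> := j))) (p \<xi>)"

definition hinner :: "setting \<Rightarrow> (gidx \<Rightarrow> state) \<Rightarrow> (gidx \<Rightarrow> state) \<Rightarrow> real" where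
  "hinner M g f = (\<Sum>p\<in>grid M. (\<Prod>\<xi>\<in>UNIV. wt M \<xi> (p \<xi>)) * (g p \<bullet> f p))"

subsection \<open>Metric, material and elastic operators\<close>

definition jac :: "setting \<Rightarrow> side \<Rightarrow> gidx \<Rightarrow> real" where
  "jac M s p = det (matrix (frechet_derivative (emb M s) (at (node M p))))"

(* The vector of partial derivatives of the xi-th reference coordinate with respect to x, y, z. *)
definition grad :: "setting \<Rightarrow> side \<Rightarrow> 3 \<Rightarrow> gidx \<Rightarrow> real^3" where
  "grad M s \<xi> p =
     (\<chi> a. frechet_derivative (coord M s) (at (emb M s (node M p))) (axis a 1) $ \<xi>)"

definition material_ok :: "setting \<Rightarrow> bool" where
  "material_ok M \<longleftrightarrow> (\<forall>s. \<forall>p\<in>grid M. 0 < dens M s p \<and> transpose (stiff M s p) = stiff M s p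
      \<and> (\<forall>w. w \<noteq> 0 \<longrightarrow> 0 < w \<bullet> (stiff M s p *v w)))"

definition Pmat :: "setting \<Rightarrow> side \<Rightarrow> gidx \<Rightarrow> state \<Rightarrow> state" where
  "Pmat M s p w = (inverse (dens M s p) *\<^sub>R fst w, stiff M s p *v snd w)"

definition Ptilde_inv :: "setting \<Rightarrow> side \<Rightarrow> gidx \<Rightarrow> state \<Rightarrow> state" where
  "Ptilde_inv M s p w = jac M s p *\<^sub>R inv (Pmat M s p) w"

definition energy :: "setting \<Rightarrow> side \<Rightarrow> (gidx \<Rightarrow> state) \<Rightarrow> real" where
  "energy M s Q = hinner M Q (\<lambda>p. (1/2) *\<^sub>R Ptilde_inv M s p (Q p))"

definition stress_mat :: "real^6 \<Rightarrow> real^3^3" where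
  "stress_mat \<sigma> = vector [vector [\<sigma>$1, \<sigma>$4, \<sigma>$5],
                         vector [\<sigma>$4, \<sigma>$2, \<sigma>$6],
                         vector [\<sigma>$5, \<sigma>$6, \<sigma>$3]]"

definition sym6 :: "real^3 \<Rightarrow> real^3 \<Rightarrow> real^6" where
  "sym6 a b = vector [a$1 * b$1, a$2 * b$2, a$3 * b$3,
     a$2 * b$1 + a$1 * b$2, a$3 * b$1 + a$1 * b$3, a$3 * b$2 + a$2 * b$3]"

definition flux :: "setting \<Rightarrow> side \<Rightarrow> 3 \<Rightarrow> (gidx \<Rightarrow> state) \<Rightarrow> gidx \<Rightarrow> state" where
  "flux M s \<xi> Q p = (jac M s p *\<^sub>R (stress_mat (snd (Q p)) *v grad M s \<xi> p), 0)"

definition Bterm :: "setting \<Rightarrow> side \<Rightarrow> 3 \<Rightarrow> (gidx \<Rightarrow> state) \<Rightarrow> gidx \<Rightarrow> state" where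
  "Bterm M s \<xi> Q p =
     (0, jac M s p *\<^sub>R sym6 (grad M s \<xi> p) (tensor_ext M (Dp M) \<xi> (\<lambda>p'. fst (Q p')) p))"

subsection \<open>Fault\<close>

definition fault_layer :: "setting \<Rightarrow> side \<Rightarrow> nat" where
  "fault_layer M s = (case s of Minus \<Rightarrow> npts M 1 | Plus \<Rightarrow> 0)"

definition fault_pt :: "setting \<Rightarrow> side \<Rightarrow> nat \<Rightarrow> nat \<Rightarrow> gidx" where
  "fault_pt M s j k = (\<lambda>\<xi>. if \<xi> = 1 then fault_layer M s else if \<xi> = 2 then j else k)"

definition conforming :: "setting \<Rightarrow> bool" where
  "conforming M \<longleftrightarrow> (\<forall>r\<in>{0..1}. \<forall>s\<in>{0..1}.
     emb M Minus (vector [1, r, s]) = emb M Plus (vector [0, r, s]))"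

(* The unit normal and the surface factor are evaluated in the minus block.  By conformity the
   plus block gives the same values: J grad q is the cross product of the r- and s-derivatives
   of the embedding, which only depends on the parametrization of the face. *)
definition fault_normal :: "setting \<Rightarrow> nat \<Rightarrow> nat \<Rightarrow> real^3" where
  "fault_normal M j k = (let g = grad M Minus 1 (fault_pt M Minus j k) in g /\<^sub>R norm g)"

definition surf :: "setting \<Rightarrow> nat \<Rightarrow> nat \<Rightarrow> real" where
  "surf M j k = (let p = fault_pt M Minus j k in jac M Minus p * norm (grad M Minus 1 p))"

definition Iq :: "setting \<Rightarrow> (nat \<Rightarrow> nat \<Rightarrow> real) \<Rightarrow> real" where
  "Iq M g = (\<Sum>j\<le>npts M 2. \<Sum>k\<le>npts M 3. surf M j k * g j k * wt M 2 j * wt M 3 k)"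

definition orthonormal_frame :: "setting \<Rightarrow> bool" where
  "orthonormal_frame M \<longleftrightarrow> (\<forall>j\<le>npts M 2. \<forall>k\<le>npts M 3.
      norm (fault_normal M j k) = 1 \<and> norm (tan_m M j k) = 1 \<and> norm (tan_l M j k) = 1
      \<and> fault_normal M j k \<bullet> tan_m M j k = 0 \<and> fault_normal M j k \<bullet> tan_l M j k = 0
      \<and> tan_m M j k \<bullet> tan_l M j k = 0)"

definition rot :: "setting \<Rightarrow> nat \<Rightarrow> nat \<Rightarrow> real^3^3" where
  "rot M j k = vector [fault_normal M j k, tan_m M j k, tan_l M j k]"

definition vloc :: "setting \<Rightarrow> side \<Rightarrow> (gidx \<Rightarrow> state) \<Rightarrow> nat \<Rightarrow> nat \<Rightarrow> real^3" where
  "vloc M s Q j k = rot M j k *v fst (Q (fault_pt M s j k))"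

definition Tloc :: "setting \<Rightarrow> side \<Rightarrow> (gidx \<Rightarrow> state) \<Rightarrow> nat \<Rightarrow> nat \<Rightarrow> real^3" where
  "Tloc M s Q j k = rot M j k *v (stress_mat (snd (Q (fault_pt M s j k))) *v fault_normal M j k)"

(* Fault data at one instant, indexed by the fault grid points. *)
record fault_state =
  vhat :: "side \<Rightarrow> nat \<Rightarrow> nat \<Rightarrow> real^3"
  That :: "nat \<Rightarrow> nat \<Rightarrow> real^3"
  alpha :: "nat \<Rightarrow> nat \<Rightarrow> real"
  psi :: "nat \<Rightarrow> nat \<Rightarrow> real"

definition jump :: "fault_state \<Rightarrow> nat \<Rightarrow> nat \<Rightarrow> real^3" where
  "jump X j k = vhat X Plus j k - vhat X Minus j k"

definition Vhat :: "fault_state \<Rightarrow> nat \<Rightarrow> nat \<Rightarrow> real" where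
  "Vhat X j k = sqrt ((jump X j k $ 3)\<^sup>2 + (jump X j k $ 2)\<^sup>2)"

definition sigma_n :: "fault_state \<Rightarrow> nat \<Rightarrow> nat \<Rightarrow> real" where
  "sigma_n X j k = - (That X j k $ 1)"

definition hat_conditions ::
    "setting \<Rightarrow> (side \<Rightarrow> gidx \<Rightarrow> state) \<Rightarrow> fault_state \<Rightarrow> nat \<Rightarrow> nat \<Rightarrow> bool" where
  "hat_conditions M Q X j k \<longleftrightarrow>
     (\<forall>i. imp M Plus j k $ i * vhat X Plus j k $ i + That X j k $ i
        = imp M Plus j k $ i * vloc M Plus (Q Plus) j k $ i + Tloc M Plus (Q Plus) j k $ i) \<and>
     (\<forall>i. imp M Minus j k $ i * vhat X Minus j k $ i - That X j k $ i
        = imp M Minus j k $ i * vloc M Minus (Q Minus) j k $ i - Tloc M Minus (Q Minus) j k $ i) \<and>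
     jump X j k $ 1 = 0 \<and>
     (\<forall>i\<in>{2, 3}. That X j k $ i = alpha X j k * jump X j k $ i) \<and>
     0 < sigma_n X j k \<and>
     (if Vhat X j k = 0 then 0 \<le> alpha X j k
      else alpha X j k = sigma_n X j k * fric M (Vhat X j k) (psi X j k) / Vhat X j k)"

definition pen :: "setting \<Rightarrow> side \<Rightarrow> (gidx \<Rightarrow> state) \<Rightarrow> fault_state \<Rightarrow> nat \<Rightarrow> nat \<Rightarrow> real^3" where
  "pen M s Q X j k =
     (\<chi> i. 1/2 * imp M s j k $ i * (vloc M s Q j k $ i - vhat X s j k $ i)
         - sg s * (1/2) * (Tloc M s Q j k $ i - That X j k $ i))"

definition pen_tilde ::
    "setting \<Rightarrow> side \<Rightarrow> (gidx \<Rightarrow> state) \<Rightarrow> fault_state \<Rightarrow> nat \<Rightarrow> nat \<Rightarrow> real^3" where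
  "pen_tilde M s Q X j k = (\<chi> i. pen M s Q X j k $ i / imp M s j k $ i)"

definition SAT_vec ::
    "setting \<Rightarrow> side \<Rightarrow> (gidx \<Rightarrow> state) \<Rightarrow> fault_state \<Rightarrow> nat \<Rightarrow> nat \<Rightarrow> state" where
  "SAT_vec M s Q X j k =
     (transpose (rot M j k) *v pen M s Q X j k,
      - sg s *\<^sub>R sym6 (fault_normal M j k) (transpose (rot M j k) *v pen_tilde M s Q X j k))"

definition SAT_q ::
    "setting \<Rightarrow> side \<Rightarrow> (gidx \<Rightarrow> state) \<Rightarrow> fault_state \<Rightarrow> gidx \<Rightarrow> state" where
  "SAT_q M s Q X p =
     (if p 1 = fault_layer M s
      then - (1 / wt M 1 (fault_layer M s) * surf M (p 2) (p 3)) *\<^sub>R SAT_vec M s Q X (p 2) (p 3)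
      else 0)"

subsection \<open>Semi-discrete problem and energy rates\<close>

definition face_term :: "setting \<Rightarrow> side \<Rightarrow> 3 \<Rightarrow> nat \<Rightarrow> (gidx \<Rightarrow> state) \<Rightarrow> real" where
  "face_term M s \<xi> b Q =
     (\<Sum>p\<in>{p\<in>grid M. p \<xi> = b}. (\<Prod>\<eta>\<in>UNIV - {\<xi>}. wt M \<eta> (p \<eta>)) * (Q p \<bullet> flux M s \<xi> Q p))"

definition outer_faces_zero :: "setting \<Rightarrow> side \<Rightarrow> (gidx \<Rightarrow> state) \<Rightarrow> bool" where
  "outer_faces_zero M s Q \<longleftrightarrow>
     (\<forall>\<xi>. \<forall>b\<in>{0, npts M \<xi>}. (\<xi>, b) \<noteq> (1, fault_layer M s) \<longrightarrow> face_term M s \<xi> b Q = 0)"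

definition solves_at ::
    "setting \<Rightarrow> side \<Rightarrow> real set \<Rightarrow> (real \<Rightarrow> gidx \<Rightarrow> state) \<Rightarrow> fault_state \<Rightarrow> real \<Rightarrow> bool" where
  "solves_at M s I Q X t \<longleftrightarrow>
     (\<forall>p\<in>grid M. \<exists>Q'. ((\<lambda>\<tau>. Q \<tau> p) has_vector_derivative Q') (at t within I) \<and>
        Ptilde_inv M s p Q' =
          (\<Sum>\<xi>\<in>UNIV. tensor_ext M (Dm M) \<xi> (flux M s \<xi> (Q t)) p)
          + (\<Sum>\<xi>\<in>UNIV. Bterm M s \<xi> (Q t) p)
          + SAT_q M s (Q t) X p)"

definition Fluc :: "setting \<Rightarrow> side \<Rightarrow> (gidx \<Rightarrow> state) \<Rightarrow> fault_state \<Rightarrow> real" where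
  "Fluc M s Q X =
     - Iq M (\<lambda>j k. \<Sum>i\<in>UNIV. 1 / imp M s j k $ i * \<bar>pen M s Q X j k $ i\<bar>\<^sup>2)"

definition ITs :: "setting \<Rightarrow> fault_state \<Rightarrow> real" where
  "ITs M X = - Iq M (\<lambda>j k. alpha X j k * \<bar>Vhat X j k\<bar>\<^sup>2)"

end

theory Submission
  imports Defs
begin

text \<open>
  The elastic flux and the gradient term are adjoint: the stress paired with \<open>B\<^sub>\<xi>\<close> equals the
  flux paired with the differenced velocity. Dual-pairing summation by parts therefore reduces the
  energy rate of each block to its face terms, and only the fault face survives, where the rate
  density is \<open>\<mp> v \<bullet> T - v \<bullet> G \<plusminus> T \<bullet> G/Z\<close> in local components. The hat equations say
  \<open>v = v' + G/Z\<close> and \<open>T = T' \<mp> G\<close> (with primes for hats), which turns this density into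
  \<open>\<mp> v' T' - G\<^sup>2/Z\<close> in each component; adding the two blocks leaves \<open>- T' \<bullet> [v']\<close>, which the friction
  law and the absence of opening evaluate to \<open>- \<alpha> V\<^sup>2\<close>. For the two blocks to share one surface
  factor and normal one needs that \<open>J \<nabla>q\<close> is the cross product of the two tangential derivatives of
  the parametrization of the fault.
\<close>

section \<open>Six-component stress vectors and the stress contraction\<close>

lemma vector_6:
  fixes a b c d e f :: "'a::zero"
  shows "(vector [a,b,c,d,e,f] :: 'a^6) $ 1 = a" "(vector [a,b,c,d,e,f] :: 'a^6) $ 2 = b"
    "(vector [a,b,c,d,e,f] :: 'a^6) $ 3 = c" "(vector [a,b,c,d,e,f] :: 'a^6) $ 4 = d"
    "(vector [a,b,c,d,e,f] :: 'a^6) $ 5 = e" "(vector [a,b,c,d,e,f] :: 'a^6) $ 6 = f"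
  by (simp_all add: vector_def)

lemma UNIV_6: "UNIV = {1::6, 2, 3, 4, 5, 6}"
proof -
  have "card {1::6, 2, 3, 4, 5, 6} = CARD(6)" by simp
  then show ?thesis by (rule card_eq_UNIV_imp_eq_UNIV[OF finite, symmetric])
qed

lemma sum_6: "sum f (UNIV :: 6 set) = f 1 + f 2 + f 3 + f 4 + f 5 + f 6"
  unfolding UNIV_6 by (simp add: add.assoc)

text \<open>Each shear entry of \<open>sym6\<close> collects two mirrored products because each
  shear stress occurs twice in \<open>stress_mat\<close>. The identity serves both the gradient term
  and the stress part of the penalty.\<close>

lemma inner_sym6: "\<sigma> \<bullet> sym6 a b = (stress_mat \<sigma> *v a) \<bullet> b"
  unfolding inner_vec_def sym6_def stress_mat_def matrix_vector_mult_def sum_6 sum_3 vector_6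
    vector_3 vec_lambda_beta inner_real_def
  by algebra

section \<open>Summation by parts on the three-dimensional grid\<close>

lemma tensor_ext_fst: "fst (tensor_ext M D \<xi> f p) = tensor_ext M D \<xi> (\<lambda>p. fst (f p)) p"
  by (simp add: tensor_ext_def ap1_def fst_sum)

lemma tensor_ext_snd: "snd (tensor_ext M D \<xi> f p) = tensor_ext M D \<xi> (\<lambda>p. snd (f p)) p"
  by (simp add: tensor_ext_def ap1_def snd_sum)

lemma ap1_nth: "ap1 n D f i $ a = ap1 n D (\<lambda>j. f j $ a) i"
  by (simp add: ap1_def)

lemma dp_sbp_vec:
  fixes f g :: "nat \<Rightarrow> real^'a"
  assumes "dp_sbp M" and n_def: "n = npts M \<xi>"
  shows "(\<Sum>i\<le>n. wt M \<xi> i * (ap1 n (Dp M \<xi>) f i \<bullet> g i + f i \<bullet> ap1 n (Dm M \<xi>) g i))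
    = f n \<bullet> g n - f 0 \<bullet> g 0"
proof -
  have *: "(\<Sum>i\<le>n. ap1 n (Dp M \<xi>) (\<lambda>j. f j $ a) i * wt M \<xi> i * g i $ a)
      + (\<Sum>i\<le>n. f i $ a * wt M \<xi> i * ap1 n (Dm M \<xi>) (\<lambda>j. g j $ a) i)
      = f n $ a * g n $ a - f 0 $ a * g 0 $ a" for a
    using assms(1)[unfolded dp_sbp_def, rule_format, THEN conjunct2, THEN conjunct2, rule_format,
        of \<xi> "\<lambda>j. f j $ a" "\<lambda>j. g j $ a"]
    unfolding n_def .
  have "(\<Sum>i\<le>n. wt M \<xi> i * (ap1 n (Dp M \<xi>) f i \<bullet> g i + f i \<bullet> ap1 n (Dm M \<xi>) g i))
    = (\<Sum>i\<le>n. \<Sum>a\<in>UNIV. ap1 n (Dp M \<xi>) (\<lambda>j. f j $ a) i * wt M \<xi> i * g i $ a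
        + f i $ a * wt M \<xi> i * ap1 n (Dm M \<xi>) (\<lambda>j. g j $ a) i)"
    by (simp add: inner_vec_def ap1_nth sum_distrib_left sum.distrib distrib_left mult_ac)
  also have "\<dots> = (\<Sum>a\<in>UNIV. f n $ a * g n $ a - f 0 $ a * g 0 $ a)"
    by (subst sum.swap) (simp add: sum.distrib *)
  finally show ?thesis by (simp add: inner_vec_def sum_subtractf)
qed

lemma finite_grid: "finite (grid M)"
proof -
  have "grid M = (\<Pi>\<^sub>E \<xi>\<in>UNIV. {..npts M \<xi>})"
    by (auto simp: grid_def PiE_def)
  then show ?thesis by (simp add: finite_PiE)
qed

text \<open>The grid is fibred into lines in direction \<xi>, each represented by its point in the
  slice \<open>b\<close>. The choice of \<open>b\<close> is free, since that coordinate is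
  overwritten.\<close>

lemma sum_grid_slice:
  assumes "b \<le> npts M \<xi>"
  shows "(\<Sum>p\<in>grid M. F p) = (\<Sum>p\<in>{p\<in>grid M. p \<xi> = b}. \<Sum>i\<le>npts M \<xi>. F (p(\<xi> := i)))"
proof -
  have "(\<Sum>p\<in>grid M. F p)
      = (\<Sum>(p, i)\<in>{p\<in>grid M. p \<xi> = b} \<times> {..npts M \<xi>}. F (p(\<xi> := i)))"
    by (rule sum.reindex_bij_witness[of _ "\<lambda>(p, i). p(\<xi> := i)" "\<lambda>p. (p(\<xi> := b), p \<xi>)"])
      (use assms in \<open>auto simp: grid_def\<close>)
  then show ?thesis by (simp add: sum.cartesian_product)
qed

lemma sum_slice_shift:
  assumes "b \<le> npts M \<xi>" "c \<le> npts M \<xi>"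
  shows "(\<Sum>p\<in>{p\<in>grid M. p \<xi> = b}. F (p(\<xi> := c))) = (\<Sum>p\<in>{p\<in>grid M. p \<xi> = c}. F p)"
  by (rule sum.reindex_bij_witness[of _ "\<lambda>p. p(\<xi> := b)" "\<lambda>p. p(\<xi> := c)"])
    (use assms in \<open>auto simp: grid_def\<close>)

lemma prod_wt_split:
  "(\<Prod>\<eta>\<in>UNIV. wt M \<eta> (p \<eta>)) = wt M \<xi> (p \<xi>) * (\<Prod>\<eta>\<in>UNIV - {\<xi>}. wt M \<eta> (p \<eta>))"
  by (rule prod.remove) auto

lemma prod_wt_upd:
  "(\<Prod>\<eta>\<in>UNIV - {\<xi>}. wt M \<eta> ((p(\<xi> := i)) \<eta>)) = (\<Prod>\<eta>\<in>UNIV - {\<xi>}. wt M \<eta> (p \<eta>))"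
  by (rule prod.cong) auto

text \<open>The transverse weights are constant along a line in direction \<xi>, so the
  one-dimensional identity collapses each line to its two end points.\<close>

lemma grid_sbp:
  fixes f g :: "gidx \<Rightarrow> real^'a"
  assumes "dp_sbp M"
  shows "(\<Sum>p\<in>grid M. (\<Prod>\<eta>\<in>UNIV. wt M \<eta> (p \<eta>)) *
        (tensor_ext M (Dp M) \<xi> f p \<bullet> g p + f p \<bullet> tensor_ext M (Dm M) \<xi> g p))
    = (\<Sum>p\<in>{p\<in>grid M. p \<xi> = npts M \<xi>}. (\<Prod>\<eta>\<in>UNIV - {\<xi>}. wt M \<eta> (p \<eta>)) * (f p \<bullet> g p))
    - (\<Sum>p\<in>{p\<in>grid M. p \<xi> = 0}. (\<Prod>\<eta>\<in>UNIV - {\<xi>}. wt M \<eta> (p \<eta>)) * (f p \<bullet> g p))"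
    (is "?L = ?R")
proof -
  let ?W = "\<lambda>p. \<Prod>\<eta>\<in>UNIV - {\<xi>}. wt M \<eta> (p \<eta>)"
  let ?n = "npts M \<xi>"
  have line: "(\<Sum>i\<le>?n. (\<Prod>\<eta>\<in>UNIV. wt M \<eta> ((p(\<xi> := i)) \<eta>)) *
        (tensor_ext M (Dp M) \<xi> f (p(\<xi> := i)) \<bullet> g (p(\<xi> := i))
          + f (p(\<xi> := i)) \<bullet> tensor_ext M (Dm M) \<xi> g (p(\<xi> := i))))
      = ?W p * (f (p(\<xi> := ?n)) \<bullet> g (p(\<xi> := ?n)) - f (p(\<xi> := 0)) \<bullet> g (p(\<xi> := 0)))" for p
    \<comment> \<open>The end-point difference is expanded back into the one-dimensional sum, so
      that both sides become the same weighted sum.\<close>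
    unfolding dp_sbp_vec[OF assms refl, of \<xi> "\<lambda>j. f (p(\<xi> := j))" "\<lambda>j. g (p(\<xi> := j))", symmetric]
      sum_distrib_left prod_wt_split[where \<xi>=\<xi>] prod_wt_upd
    by (simp add: tensor_ext_def mult_ac)
  have "?L = (\<Sum>p\<in>{p\<in>grid M. p \<xi> = 0}. ?W (p(\<xi> := ?n)) * (f (p(\<xi> := ?n)) \<bullet> g (p(\<xi> := ?n))))
    - (\<Sum>p\<in>{p\<in>grid M. p \<xi> = 0}. ?W (p(\<xi> := 0)) * (f (p(\<xi> := 0)) \<bullet> g (p(\<xi> := 0))))"
    unfolding sum_grid_slice[of 0 M \<xi>, simplified] line prod_wt_upd
    by (simp add: right_diff_distrib sum_subtractf)
  also have "\<dots> = ?R"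
    \<comment> \<open>The lines are indexed by their points on face 0; their upper ends are
      re-indexed by the opposite face.\<close>
    using sum_slice_shift[of 0 M \<xi> ?n "\<lambda>p. ?W p * (f p \<bullet> g p)"]
      sum_slice_shift[of 0 M \<xi> 0 "\<lambda>p. ?W p * (f p \<bullet> g p)"] by simp
  finally show ?thesis .
qed

text \<open>By \<open>inner_sym6\<close> the metric factor outside the difference in
  \<open>Bterm\<close> moves onto the stress and forms the flux. This produces the pairing required
  by \<open>grid_sbp\<close>, with no product rule for the varying metric.\<close>

lemma volume_terms:
  assumes "dp_sbp M"
  shows "hinner M Q (\<lambda>p. tensor_ext M (Dm M) \<xi> (flux M s \<xi> Q) p + Bterm M s \<xi> Q p)
    = face_term M s \<xi> (npts M \<xi>) Q - face_term M s \<xi> 0 Q"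
proof -
  have "Q p \<bullet> (tensor_ext M (Dm M) \<xi> (flux M s \<xi> Q) p + Bterm M s \<xi> Q p)
      = tensor_ext M (Dp M) \<xi> (\<lambda>p. fst (Q p)) p \<bullet> fst (flux M s \<xi> Q p)
        + fst (Q p) \<bullet> tensor_ext M (Dm M) \<xi> (\<lambda>p. fst (flux M s \<xi> Q p)) p" for p
  proof -
    have "snd (tensor_ext M (Dm M) \<xi> (flux M s \<xi> Q) p) = 0"
      by (simp add: tensor_ext_snd flux_def) (simp add: tensor_ext_def ap1_def)
    then show ?thesis
      by (simp add: inner_prod_def tensor_ext_fst Bterm_def inner_sym6 flux_def inner_commute)
  qed
  moreover have "Q p \<bullet> flux M s \<xi> Q p = fst (Q p) \<bullet> fst (flux M s \<xi> Q p)" for p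
    by (simp add: inner_prod_def flux_def)
  ultimately show ?thesis
    unfolding hinner_def face_term_def by (simp add: grid_sbp[OF assms])
qed

section \<open>Fault layer, local frame and penalty work\<close>

lemma fault_pt_eta: "p 1 = fault_layer M s \<Longrightarrow> fault_pt M s (p 2) (p 3) = p"
  by (simp add: fault_pt_def fun_eq_iff forall_3)

lemma fault_pt_grid: "j \<le> npts M 2 \<Longrightarrow> k \<le> npts M 3 \<Longrightarrow> fault_pt M s j k \<in> grid M"
  by (cases s) (simp_all add: grid_def fault_pt_def fault_layer_def forall_3)

lemma sum_fault_layer:
  "(\<Sum>p\<in>{p\<in>grid M. p 1 = fault_layer M s}. F p)
    = (\<Sum>j\<le>npts M 2. \<Sum>k\<le>npts M 3. F (fault_pt M s j k))"
proof -
  have "(\<Sum>p\<in>{p\<in>grid M. p 1 = fault_layer M s}. F p)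
    = (\<Sum>(j, k)\<in>{..npts M 2} \<times> {..npts M 3}. F (fault_pt M s j k))"
    by (rule sum.reindex_bij_witness[of _ "\<lambda>(j, k). fault_pt M s j k" "\<lambda>p. (p 2, p 3)"])
      (auto simp: fault_pt_eta fault_pt_grid, auto simp: grid_def fault_pt_def)
  then show ?thesis by (simp add: sum.cartesian_product)
qed

lemma prod_wt_fault: "(\<Prod>\<eta>\<in>UNIV - {1}. wt M \<eta> (fault_pt M s j k \<eta>)) = wt M 2 j * wt M 3 k"
proof -
  have "UNIV - {1::3} = {2, 3}" unfolding UNIV_3 by auto
  then show ?thesis by (simp add: fault_pt_def)
qed

lemma rot_adjoint: "x \<bullet> (transpose (rot M j k) *v y) = (rot M j k *v x) \<bullet> y"
  by (metis dot_lmul_matrix inner_commute transpose_matrix_vector)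

text \<open>Orthonormality is given for the rows, i.e. \<open>R R^T = I\<close>. Since the matrix is
  square, also \<open>R^T R = I\<close>, which is what preserving inner products requires.\<close>

lemma rot_isometry:
  assumes "orthonormal_frame M" "j \<le> npts M 2" "k \<le> npts M 3"
  shows "(rot M j k *v x) \<bullet> (rot M j k *v y) = x \<bullet> y"
proof -
  have "rot M j k ** transpose (rot M j k) = mat 1"
    using assms unfolding orthonormal_frame_def
    by (simp add: vec_eq_iff forall_3 matrix_matrix_mult_def transpose_def rot_def mat_def
        norm_eq_1 inner_vec_def mult_ac)
  then have "transpose (rot M j k) ** rot M j k = mat 1"
    using matrix_left_right_inverse by blast
  then show ?thesis
    by (metis matrix_vector_mul_assoc matrix_vector_mul_lid rot_adjoint)
qed

text \<open>The factor \<open>1 / wt\<close> in the penalty cancels the normal quadrature weight of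
  the fault layer and leaves a surface quadrature. The stress components contribute traction times
  \<open>pen_tilde\<close> through \<open>inner_sym6\<close>.\<close>

lemma hinner_SAT:
  assumes "dp_sbp M"
  shows "hinner M Q (SAT_q M s Q X) =
    - Iq M (\<lambda>j k. vloc M s Q j k \<bullet> pen M s Q X j k - sg s * (Tloc M s Q j k \<bullet> pen_tilde M s Q X j k))"
    (is "_ = - Iq M ?g")
proof -
  let ?b = "fault_layer M s"
  have b: "0 < wt M 1 ?b"
    using assms by (auto simp: dp_sbp_def fault_layer_def split: side.splits)
  have sat: "Q (fault_pt M s j k) \<bullet> SAT_vec M s Q X j k = ?g j k" for j k
    by (simp add: SAT_vec_def inner_prod_def inner_sym6 rot_adjoint vloc_def Tloc_def
        del: transpose_matrix_vector)
  let ?F = "\<lambda>p. (\<Prod>\<xi>\<in>UNIV. wt M \<xi> (p \<xi>)) * (Q p \<bullet> SAT_q M s Q X p)"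
  have "hinner M Q (SAT_q M s Q X) = (\<Sum>p\<in>{p\<in>grid M. p 1 = ?b}. ?F p)"
    unfolding hinner_def
    by (rule sum.mono_neutral_right) (auto simp: finite_grid SAT_q_def)
  also have "\<dots> = (\<Sum>j\<le>npts M 2. \<Sum>k\<le>npts M 3. - (surf M j k * ?g j k * wt M 2 j * wt M 3 k))"
    unfolding sum_fault_layer
  proof (intro sum.cong refl)
    fix j k
    have "?F (fault_pt M s j k) = wt M 1 ?b * (wt M 2 j * wt M 3 k) *
        (- (1 / wt M 1 ?b * surf M j k) * ?g j k)"
      unfolding prod_wt_split[where \<xi>=1] prod_wt_fault sat[symmetric]
      by (simp add: SAT_q_def fault_pt_def)
    then show "?F (fault_pt M s j k) = - (surf M j k * ?g j k * wt M 2 j * wt M 3 k)"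
      using b by simp
  qed
  finally show ?thesis by (simp add: Iq_def sum_negf)
qed

section \<open>Material operator and time derivative of the energy\<close>

lemma Pmat_linear: "linear (Pmat M s p)"
  by (rule linearI)
    (simp_all add: Pmat_def scaleR_add_right matrix_vector_right_distrib matrix_vector_mult_scaleR)

text \<open>Positive density and a definite stiffness give \<open>Pmat\<close> a trivial kernel, so
  in finite dimension it is bijective and \<open>inv\<close> is a true inverse. Symmetry passes to
  it by inserting preimages.\<close>

lemma Ptilde_inv_linear_symmetric:
  assumes "material_ok M" "p \<in> grid M"
  shows "linear (Ptilde_inv M s p)"
    and "Ptilde_inv M s p x \<bullet> y = x \<bullet> Ptilde_inv M s p y"
proof -
  let ?P = "Pmat M s p"
  have dens: "0 < dens M s p" and symm: "transpose (stiff M s p) = stiff M s p"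
    and pos: "\<And>w. w \<noteq> 0 \<Longrightarrow> 0 < w \<bullet> (stiff M s p *v w)"
    using assms by (auto simp: material_ok_def)
  have sym: "?P x \<bullet> y = x \<bullet> ?P y" for x y
  proof -
    have "(stiff M s p *v snd x) \<bullet> snd y = snd x \<bullet> (stiff M s p *v snd y)"
      by (metis dot_lmul_matrix symm transpose_matrix_vector)
    then show ?thesis by (simp add: Pmat_def inner_prod_def)
  qed
  have inj: "inj ?P"
    unfolding linear_injective_0[OF Pmat_linear]
  proof (intro allI impI)
    fix w assume w: "?P w = 0"
    then have "fst w = 0" and "stiff M s p *v snd w = 0"
      using dens by (auto simp: Pmat_def zero_prod_def)
    moreover from this have "snd w = 0" using pos by force
    ultimately show "w = 0" by (simp add: prod_eq_iff)
  qed
  have surj: "surj ?P"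
    by (rule linear_inj_imp_surj[OF Pmat_linear inj])
  show "linear (Ptilde_inv M s p)"
    unfolding Ptilde_inv_def [abs_def]
    by (intro linear_compose_scale_right inj_linear_imp_inv_linear Pmat_linear inj)
  have "inv ?P x \<bullet> y = x \<bullet> inv ?P y"
    using sym[of "inv ?P x" "inv ?P y"] by (simp add: surj_f_inv_f[OF surj])
  then show "Ptilde_inv M s p x \<bullet> y = x \<bullet> Ptilde_inv M s p y"
    by (simp add: Ptilde_inv_def)
qed

text \<open>The product rule gives two halves, which are equal by symmetry of
  \<open>Ptilde_inv\<close> and absorb the factor 1/2.\<close>

lemma energy_derivative:
  assumes mat: "material_ok M"
    and der: "\<And>p. p \<in> grid M \<Longrightarrow> ((\<lambda>\<tau>. Q \<tau> p) has_vector_derivative Q' p) (at t within I)"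
  shows "((\<lambda>\<tau>. energy M s (Q \<tau>)) has_real_derivative
    hinner M (Q t) (\<lambda>p. Ptilde_inv M s p (Q' p))) (at t within I)"
  unfolding energy_def hinner_def
proof (intro DERIV_sum DERIV_cmult)
  fix p assume p: "p \<in> grid M"
  let ?L = "Ptilde_inv M s p"
  have L: "bounded_linear ?L"
    using Ptilde_inv_linear_symmetric(1)[OF mat p] by (simp add: linear_conv_bounded_linear)
  have "((\<lambda>\<tau>. Q \<tau> p \<bullet> ((1/2) *\<^sub>R ?L (Q \<tau> p))) has_vector_derivative
      Q t p \<bullet> ((1/2) *\<^sub>R ?L (Q' p)) + Q' p \<bullet> ((1/2) *\<^sub>R ?L (Q t p))) (at t within I)"
    by (intro bounded_bilinear.has_vector_derivative[OF bounded_bilinear_inner] der[OF p]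
        bounded_linear.has_vector_derivative[OF bounded_linear_scaleR_right]
        bounded_linear.has_vector_derivative[OF L])
  moreover have "Q' p \<bullet> ?L (Q t p) = Q t p \<bullet> ?L (Q' p)"
    by (metis Ptilde_inv_linear_symmetric(2)[OF mat p] inner_commute)
  ultimately show "((\<lambda>\<tau>. Q \<tau> p \<bullet> ((1/2) *\<^sub>R ?L (Q \<tau> p))) has_real_derivative
      Q t p \<bullet> ?L (Q' p)) (at t within I)"
    by (simp add: has_real_derivative_iff_has_vector_derivative)
qed

section \<open>Metric terms and their agreement across the fault\<close>

lemma smooth_on_differentiable: "smooth_on f S \<Longrightarrow> x \<in> S \<Longrightarrow> f differentiable (at x)"
  unfolding smooth_on_def by (metis Ck_on.simps(2))

text \<open>The chain rule is applied to \<open>\<gamma> \<circ> \<phi> = id\<close>. This holds on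
  an open neighbourhood of the cube, so full derivatives exist at boundary nodes too, in particular
  on the fault.\<close>

lemma smooth_coords_derivatives:
  assumes "smooth_coords \<phi> \<gamma>" "u \<in> unit_cube"
  shows "(\<phi> has_derivative frechet_derivative \<phi> (at u)) (at u)"
    and "(\<gamma> has_derivative frechet_derivative \<gamma> (at (\<phi> u))) (at (\<phi> u))"
    and "frechet_derivative \<gamma> (at (\<phi> u)) (frechet_derivative \<phi> (at u) v) = v"
proof -
  obtain U W where UW: "open U" "unit_cube \<subseteq> U" "smooth_on \<phi> U" "smooth_on \<gamma> W"
      "\<phi> ` U = W" "\<And>u. u \<in> U \<Longrightarrow> \<gamma> (\<phi> u) = u"
    using assms unfolding smooth_coords_def by blast
  have u: "u \<in> U" using UW assms by blast
  show 1: "(\<phi> has_derivative frechet_derivative \<phi> (at u)) (at u)"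
    using smooth_on_differentiable[OF UW(3) u] frechet_derivative_works by blast
  show 2: "(\<gamma> has_derivative frechet_derivative \<gamma> (at (\<phi> u))) (at (\<phi> u))"
    using smooth_on_differentiable[OF UW(4)] u UW(5) frechet_derivative_works by blast
  have "((\<gamma> \<circ> \<phi>) has_derivative frechet_derivative \<gamma> (at (\<phi> u)) \<circ> frechet_derivative \<phi> (at u)) (at u)"
    by (rule diff_chain_at[OF 1 2])
  moreover have "((\<gamma> \<circ> \<phi>) has_derivative id) (at u)"
    by (rule has_derivative_transform_within_open[OF has_derivative_id UW(1) u]) (simp add: UW(6))
  ultimately have "frechet_derivative \<gamma> (at (\<phi> u)) \<circ> frechet_derivative \<phi> (at u) = id"
    by (rule has_derivative_unique)
  then show "frechet_derivative \<gamma> (at (\<phi> u)) (frechet_derivative \<phi> (at u) v) = v"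
    by (metis comp_apply id_apply)
qed

lemma node_in_unit_cube:
  assumes "dp_sbp M" "p \<in> grid M"
  shows "node M p \<in> unit_cube"
  using assms
  by (auto simp: unit_cube_def mem_box_cart node_def grid_def dp_sbp_def divide_le_eq_1)

text \<open>Row 1 of Cramer's rule: the cofactors are the entries of the cross product.\<close>
lemma scaled_inverse_row_eq_cross3:
  fixes A B :: "real^3^3"
  assumes "B ** A = mat 1"
  shows "det A *\<^sub>R B $ 1 = cross3 (column 2 A) (column 3 A)"
proof -
  have "(B ** A) $ 1 $ i = mat 1 $ 1 $ i" for i using assms by simp
  from this[of 1] this[of 2] this[of 3] show ?thesis
    unfolding det_3
    by (simp add: vec_eq_iff forall_3 cross3_def column_def matrix_matrix_mult_def mat_def sum_3)
      algebra
qed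

text \<open>The gradient is the first row of the inverse of the Jacobian matrix. Scaled by the
  determinant it involves only tangential derivatives of the embedding, the ones that conformity
  controls.\<close>

lemma jac_grad_eq_cross3:
  assumes "dp_sbp M" "smooth_coords (emb M s) (coord M s)" "p \<in> grid M"
  defines "D \<equiv> frechet_derivative (emb M s) (at (node M p))"
  shows "jac M s p *\<^sub>R grad M s 1 p = cross3 (D (axis 2 1)) (D (axis 3 1))"
proof -
  note d = smooth_coords_derivatives[OF assms(2) node_in_unit_cube[OF assms(1,3)], folded D_def]
  define E where "E = frechet_derivative (coord M s) (at (emb M s (node M p)))"
  have lin: "linear D" "linear E"
    using d(1,2) by (auto simp: E_def intro: has_derivative_linear)
  have "matrix E ** matrix D = matrix (E \<circ> D)"
    by (rule matrix_compose[symmetric]) (use lin in \<open>auto simp: linear_conv_bounded_linear\<close>)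
  also have "\<dots> = mat 1"
    by (simp add: comp_def E_def d(3) matrix_def mat_def axis_def vec_eq_iff)
  finally have "det (matrix D) *\<^sub>R matrix E $ 1
      = cross3 (column 2 (matrix D)) (column 3 (matrix D))"
    by (rule scaled_inverse_row_eq_cross3)
  moreover have "grad M s 1 p = matrix E $ 1"
    by (simp add: grad_def E_def matrix_def vec_eq_iff)
  moreover have "column i (matrix D) = D (axis i 1)" for i
    by (simp add: column_def matrix_def vec_eq_iff)
  ultimately show ?thesis by (simp add: jac_def D_def)
qed

text \<open>The two maps are compared on a segment only, so at its end points just the one-sided
  derivatives are available.\<close>
lemma tangential_derivatives_agree:
  fixes f g :: "real^3 \<Rightarrow> real^3"
  assumes "(f has_derivative f') (at u)" "(g has_derivative g') (at w)"
    and "0 \<le> x" "x \<le> 1"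
    and "\<And>y. 0 \<le> y \<Longrightarrow> y \<le> 1 \<Longrightarrow> f (u + (y - x) *\<^sub>R e) = g (w + (y - x) *\<^sub>R e)"
  shows "f' e = g' e"
proof -
  have *: "((\<lambda>y. h (z + (y - x) *\<^sub>R e)) has_vector_derivative h' e) (at x within {0..1})"
    if "(h has_derivative h') (at z)" for h h' and z :: "real^3"
  proof -
    have "((\<lambda>y. z + (y - x) *\<^sub>R e) has_vector_derivative e) (at x within {0..1})"
      by (auto intro!: derivative_eq_intros)
    then show ?thesis
      using vector_derivative_diff_chain_within[of "\<lambda>y. z + (y - x) *\<^sub>R e" e x "{0..1}" h h']
        that has_derivative_at_withinI by (fastforce simp: comp_def)
  qed
  have "((\<lambda>y. f (u + (y - x) *\<^sub>R e)) has_vector_derivative g' e) (at x within {0..1})"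
    by (rule has_vector_derivative_transform[OF _ _ *[OF assms(2)]]) (use assms in auto)
  then show ?thesis
    using vector_derivative_unique_within_closed_interval[of 0 1 x] *[OF assms(1)] assms
    by (metis atLeastAtMost_iff cbox_interval zero_less_one)
qed

lemma surf_normal:
  assumes "dp_sbp M" "\<And>s. smooth_coords (emb M s) (coord M s)" "conforming M"
    and jk: "j \<le> npts M 2" "k \<le> npts M 3"
  shows "jac M s (fault_pt M s j k) *\<^sub>R grad M s 1 (fault_pt M s j k)
    = surf M j k *\<^sub>R fault_normal M j k"
proof -
  let ?p = "\<lambda>s. fault_pt M s j k"
  let ?D = "\<lambda>s. frechet_derivative (emb M s) (at (node M (?p s)))"
  have g: "?p s \<in> grid M" for s
    using jk by (rule fault_pt_grid)
  define x where "x = real j / real (npts M 2)"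
  define y where "y = real k / real (npts M 3)"
  have n: "0 < npts M \<xi>" for \<xi> using assms by (auto simp: dp_sbp_def)
  have xy: "0 \<le> x" "x \<le> 1" "0 \<le> y" "y \<le> 1"
    using jk n by (auto simp: x_def y_def divide_le_eq_1)
  have nodes: "node M (?p Minus) = vector [1, x, y]" "node M (?p Plus) = vector [0, x, y]"
    using n by (simp_all add: vec_eq_iff forall_3 node_def fault_pt_def fault_layer_def x_def y_def)
  have d: "(emb M s has_derivative ?D s) (at (node M (?p s)))" for s
    by (rule smooth_coords_derivatives(1)[OF assms(2) node_in_unit_cube[OF assms(1) g]])
  \<comment> \<open>Shifting along an axis by \<open>z - x\<close> replaces the coordinate
    \<open>x\<close> by \<open>z\<close>. The comparison segment thus stays in the fault face for
    parameters in [0,1].\<close>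
  have add: "vector [a, x, y] + (z - x) *\<^sub>R axis 2 1 = (vector [a, z, y] :: real^3)"
    "vector [a, x, y] + (z - y) *\<^sub>R axis 3 1 = (vector [a, x, z] :: real^3)" for a z
    by (simp_all add: vec_eq_iff forall_3 axis_def)
  have "?D Minus (axis 2 1) = ?D Plus (axis 2 1)"
    by (rule tangential_derivatives_agree[OF d d xy(1,2)])
      (use assms(3) xy in \<open>simp add: nodes add conforming_def\<close>)
  moreover have "?D Minus (axis 3 1) = ?D Plus (axis 3 1)"
    by (rule tangential_derivatives_agree[OF d d xy(3,4)])
      (use assms(3) xy in \<open>simp add: nodes add conforming_def\<close>)
  ultimately have "jac M s (?p s) *\<^sub>R grad M s 1 (?p s)
      = jac M Minus (?p Minus) *\<^sub>R grad M Minus 1 (?p Minus)"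
    by (cases s) (simp_all add: jac_grad_eq_cross3[OF assms(1,2) g])
  \<comment> \<open>The norm in \<open>surf\<close> cancels the normalisation; for a zero gradient
    both sides vanish.\<close>
  also have "\<dots> = surf M j k *\<^sub>R fault_normal M j k"
    by (auto simp: surf_def fault_normal_def Let_def)
  finally show ?thesis .
qed

lemma surf_nonneg:
  assumes "dp_sbp M" "\<And>s. smooth_coords (emb M s) (coord M s)"
    and jk: "j \<le> npts M 2" "k \<le> npts M 3"
  shows "0 \<le> surf M j k"
proof -
  have "fault_pt M Minus j k \<in> grid M"
    using jk by (rule fault_pt_grid)
  then show ?thesis
    using assms(2)[of Minus] node_in_unit_cube[OF assms(1)]
    by (force simp: surf_def Let_def jac_def smooth_coords_def)
qed

section \<open>Fault quadrature and the energy rate of one block\<close>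

lemma Iq_add: "Iq M (\<lambda>j k. f j k + g j k) = Iq M f + Iq M g"
  by (simp add: Iq_def sum.distrib algebra_simps)

lemma Iq_uminus: "Iq M (\<lambda>j k. - g j k) = - Iq M g"
  by (simp add: Iq_def sum_negf)

lemma Iq_nonneg:
  assumes "dp_sbp M" "\<And>s. smooth_coords (emb M s) (coord M s)"
    and "\<And>j k. j \<le> npts M 2 \<Longrightarrow> k \<le> npts M 3 \<Longrightarrow> 0 \<le> g j k"
  shows "0 \<le> Iq M g"
  unfolding Iq_def
  by (intro sum_nonneg mult_nonneg_nonneg)
    (use assms surf_nonneg[OF assms(1,2)] in \<open>auto simp: dp_sbp_def less_imp_le\<close>)

text \<open>On the fault \<open>J\<close> times the gradient is \<open>surf\<close> times the
  normal, so the flux is \<open>surf\<close> times the traction; passing to local components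
  preserves its product with the velocity.\<close>

lemma fault_face_term:
  assumes "dp_sbp M" "\<And>s. smooth_coords (emb M s) (coord M s)" "conforming M"
    and "orthonormal_frame M"
  shows "face_term M s 1 (fault_layer M s) Q = Iq M (\<lambda>j k. vloc M s Q j k \<bullet> Tloc M s Q j k)"
proof -
  have "Q (fault_pt M s j k) \<bullet> flux M s 1 Q (fault_pt M s j k)
      = surf M j k * (vloc M s Q j k \<bullet> Tloc M s Q j k)"
    if jk: "j \<le> npts M 2" "k \<le> npts M 3" for j k
  proof -
    let ?p = "fault_pt M s j k"
    have "Q ?p \<bullet> flux M s 1 Q ?p
        = fst (Q ?p) \<bullet> (stress_mat (snd (Q ?p)) *v (jac M s ?p *\<^sub>R grad M s 1 ?p))"
      by (simp add: inner_prod_def flux_def matrix_vector_mult_scaleR)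
    also have "\<dots> = surf M j k * (vloc M s Q j k \<bullet> Tloc M s Q j k)"
      by (simp add: surf_normal[OF assms(1-3) jk] matrix_vector_mult_scaleR vloc_def Tloc_def
          rot_isometry[OF assms(4) jk])
    finally show ?thesis .
  qed
  then show ?thesis
    unfolding face_term_def sum_fault_layer prod_wt_fault Iq_def
    by (simp add: mult_ac)
qed

lemma block_energy_rate:
  assumes "dp_sbp M" "\<And>s. smooth_coords (emb M s) (coord M s)" "conforming M"
    and "material_ok M" "orthonormal_frame M"
    and outer: "outer_faces_zero M s (Q t)"
    and sol: "solves_at M s I Q X t"
  shows "((\<lambda>\<tau>. energy M s (Q \<tau>)) has_real_derivative
    Iq M (\<lambda>j k. - sg s * (vloc M s (Q t) j k \<bullet> Tloc M s (Q t) j k)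
      - vloc M s (Q t) j k \<bullet> pen M s (Q t) X j k
      + sg s * (Tloc M s (Q t) j k \<bullet> pen_tilde M s (Q t) X j k))) (at t within I)"
    (is "(_ has_real_derivative Iq M ?g) _")
proof -
  let ?q = "Q t"
  obtain Q' where Q': "\<forall>p\<in>grid M. ((\<lambda>\<tau>. Q \<tau> p) has_vector_derivative Q' p) (at t within I) \<and>
        Ptilde_inv M s p (Q' p) =
          (\<Sum>\<xi>\<in>UNIV. tensor_ext M (Dm M) \<xi> (flux M s \<xi> ?q) p)
          + (\<Sum>\<xi>\<in>UNIV. Bterm M s \<xi> ?q p) + SAT_q M s ?q X p"
    using sol[unfolded solves_at_def, THEN bchoice] by (elim exE)
  then have der: "\<And>p. p \<in> grid M \<Longrightarrow> ((\<lambda>\<tau>. Q \<tau> p) has_vector_derivative Q' p) (at t within I)"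
    by simp
  have n: "0 < npts M \<xi>" for \<xi> using assms by (auto simp: dp_sbp_def)
  have outer: "face_term M s \<xi> b ?q = 0"
    if "b \<in> {0, npts M \<xi>}" "(\<xi>, b) \<noteq> (1, fault_layer M s)" for \<xi> b
    using outer that unfolding outer_faces_zero_def by blast
  have "hinner M ?q (\<lambda>p. Ptilde_inv M s p (Q' p))
    = (\<Sum>\<xi>\<in>UNIV. hinner M ?q (\<lambda>p. tensor_ext M (Dm M) \<xi> (flux M s \<xi> ?q) p + Bterm M s \<xi> ?q p))
      + hinner M ?q (SAT_q M s ?q X)"
    unfolding hinner_def
    by (subst sum.swap)
      (simp add: Q' inner_add_right inner_sum_right sum_distrib_left sum.distrib distrib_left)
  \<comment> \<open>Of the six faces only the fault remains. It is the upper q-face of the minus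
    block and the lower one of the plus block, hence the sign \<open>- sg s\<close>.\<close>
  also have "(\<Sum>\<xi>\<in>UNIV. hinner M ?q
        (\<lambda>p. tensor_ext M (Dm M) \<xi> (flux M s \<xi> ?q) p + Bterm M s \<xi> ?q p))
      = - sg s * face_term M s 1 (fault_layer M s) ?q"
    using n[of 1] outer[of 0 1] outer[of "npts M 1" 1] outer[of 0 2] outer[of "npts M 2" 2]
      outer[of 0 3] outer[of "npts M 3" 3]
    by (cases s) (simp_all add: volume_terms[OF assms(1)] sum_3 fault_layer_def)
  also have "- sg s * face_term M s 1 (fault_layer M s) ?q + hinner M ?q (SAT_q M s ?q X) = Iq M ?g"
    unfolding fault_face_term[OF assms(1-3,5)] hinner_SAT[OF assms(1)]
    by (simp add: Iq_def sum_distrib_left sum_negf[symmetric] sum.distrib[symmetric] algebra_simps)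
  finally show ?thesis
    using energy_derivative[OF assms(4), where Q=Q and Q'=Q' and s=s, OF der] by simp
qed

section \<open>Pointwise algebra of the hat-variables\<close>

text \<open>The hat equation makes the two halves of \<open>G\<close> equal, so
  \<open>G = Z * (v - v') = T' - T\<close>. Then \<open>v * T + v * G = v * T'\<close>, and the
  mixed terms \<open>T' * G / Z\<close> cancel.\<close>

lemma pointwise_rate_Plus:
  fixes Z v T v' T' :: real
  assumes "0 < Z" "Z * v' + T' = Z * v + T" "G = 1/2 * Z * (v - v') - 1/2 * (T - T')"
  shows "- (v * T) - v * G + T * (G / Z) = - (v' * T') - G\<^sup>2 / Z"
proof -
  have eqs: "T = T' - G" "v = v' + G / Z"
    using assms by (auto simp: field_simps)
  show ?thesis
    unfolding eqs by (simp add: algebra_simps power2_eq_square add_divide_distrib diff_divide_distrib)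
qed

text \<open>With the traction sign reversed, \<open>G = Z * (v - v') = T - T'\<close>, and the
  cancellation is the same.\<close>

lemma pointwise_rate_Minus:
  fixes Z v T v' T' :: real
  assumes "0 < Z" "Z * v' - T' = Z * v - T" "G = 1/2 * Z * (v - v') + 1/2 * (T - T')"
  shows "v * T - v * G - T * (G / Z) = v' * T' - G\<^sup>2 / Z"
proof -
  have eqs: "T = T' + G" "v = v' + G / Z"
    using assms by (auto simp: field_simps)
  show ?thesis
    unfolding eqs by (simp add: algebra_simps power2_eq_square add_divide_distrib)
qed

lemma hat_rate_balance:
  assumes imp: "\<And>s i. 0 < imp M s j k $ i" and hat: "hat_conditions M q X j k"
  shows "(\<Sum>s\<in>{Minus, Plus}. - sg s * (vloc M s (q s) j k \<bullet> Tloc M s (q s) j k)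
      - vloc M s (q s) j k \<bullet> pen M s (q s) X j k
      + sg s * (Tloc M s (q s) j k \<bullet> pen_tilde M s (q s) X j k))
    = - (\<Sum>s\<in>{Minus, Plus}. \<Sum>i\<in>UNIV. 1 / imp M s j k $ i * \<bar>pen M s (q s) X j k $ i\<bar>\<^sup>2)
      - alpha X j k * \<bar>Vhat X j k\<bar>\<^sup>2"
proof -
  have plus: "- (vloc M Plus (q Plus) j k $ i * Tloc M Plus (q Plus) j k $ i)
      - vloc M Plus (q Plus) j k $ i * pen M Plus (q Plus) X j k $ i
      + Tloc M Plus (q Plus) j k $ i * pen_tilde M Plus (q Plus) X j k $ i
      = - (vhat X Plus j k $ i * That X j k $ i)
        - (pen M Plus (q Plus) X j k $ i)\<^sup>2 / imp M Plus j k $ i" for i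
    unfolding pen_tilde_def vec_lambda_beta
    by (rule pointwise_rate_Plus) (use imp hat in \<open>auto simp: hat_conditions_def pen_def\<close>)
  have minus: "vloc M Minus (q Minus) j k $ i * Tloc M Minus (q Minus) j k $ i
      - vloc M Minus (q Minus) j k $ i * pen M Minus (q Minus) X j k $ i
      - Tloc M Minus (q Minus) j k $ i * pen_tilde M Minus (q Minus) X j k $ i
      = vhat X Minus j k $ i * That X j k $ i
        - (pen M Minus (q Minus) X j k $ i)\<^sup>2 / imp M Minus j k $ i" for i
    unfolding pen_tilde_def vec_lambda_beta
    by (rule pointwise_rate_Minus) (use imp hat in \<open>auto simp: hat_conditions_def pen_def\<close>)
  \<comment> \<open>The normal component drops out because there is no opening; the two tangential
    ones give \<open>alpha\<close> times the sum of squares under the root in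
    \<open>Vhat\<close>.\<close>
  have friction: "That X j k \<bullet> jump X j k = alpha X j k * \<bar>Vhat X j k\<bar>\<^sup>2"
    using hat by (simp add: hat_conditions_def inner_vec_def sum_3 Vhat_def power2_eq_square
        distrib_left mult_ac)
  have "(\<Sum>s\<in>{Minus, Plus}. - sg s * (vloc M s (q s) j k \<bullet> Tloc M s (q s) j k)
      - vloc M s (q s) j k \<bullet> pen M s (q s) X j k
      + sg s * (Tloc M s (q s) j k \<bullet> pen_tilde M s (q s) X j k))
    = (\<Sum>i\<in>UNIV. (vhat X Minus j k $ i * That X j k $ i
          - (pen M Minus (q Minus) X j k $ i)\<^sup>2 / imp M Minus j k $ i)
        + (- (vhat X Plus j k $ i * That X j k $ i)
          - (pen M Plus (q Plus) X j k $ i)\<^sup>2 / imp M Plus j k $ i))"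
    unfolding plus[symmetric] minus[symmetric]
    by (simp add: inner_vec_def sum.distrib sum_subtractf sum_negf)
  \<comment> \<open>Both blocks share the hat traction, so their hat terms combine to its product
    with the velocity jump.\<close>
  also have "\<dots> = - (\<Sum>s\<in>{Minus, Plus}. \<Sum>i\<in>UNIV. 1 / imp M s j k $ i * \<bar>pen M s (q s) X j k $ i\<bar>\<^sup>2)
      - That X j k \<bullet> jump X j k"
    by (simp add: inner_vec_def jump_def sum.distrib sum_subtractf sum_negf algebra_simps)
  finally show ?thesis by (simp only: friction)
qed

text \<open>At nonzero slip rate \<open>alpha\<close> is a quotient with compressive
  \<open>sigma_n\<close> and nonnegative friction; at zero slip rate its sign is part of the hat
  conditions.\<close>

lemma hat_alpha_nonneg:
  assumes "\<And>V \<theta>. 0 \<le> V \<Longrightarrow> 0 \<le> fric M V \<theta>" "hat_conditions M q X j k"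
  shows "0 \<le> alpha X j k"
proof -
  have "0 \<le> Vhat X j k" by (simp add: Vhat_def)
  with assms show ?thesis
    by (cases "Vhat X j k = 0") (auto simp: hat_conditions_def)
qed

section \<open>Energy balance of the two coupled blocks\<close>

theorem theorem6:
  fixes M :: setting
    and I :: "real set"
    and Q :: "side \<Rightarrow> real \<Rightarrow> gidx \<Rightarrow> state"
    and X :: "real \<Rightarrow> fault_state"
  assumes sbp: "dp_sbp M"
    and geometry: "\<And>s. smooth_coords (emb M s) (coord M s)"
    and fault: "conforming M"
    and material: "material_ok M"
    and frame: "orthonormal_frame M"
    and impedance: "\<And>s j k i. j \<le> npts M 2 \<Longrightarrow> k \<le> npts M 3 \<Longrightarrow> 0 < imp M s j k $ i"
    and friction: "\<And>V \<theta>. 0 \<le> V \<Longrightarrow> 0 \<le> fric M V \<theta>"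
    and time: "is_interval I" "interior I \<noteq> {}"
    and hats: "\<And>t j k. t \<in> I \<Longrightarrow> j \<le> npts M 2 \<Longrightarrow> k \<le> npts M 3 \<Longrightarrow>
                 hat_conditions M (\<lambda>s. Q s t) (X t) j k"
    and outer: "\<And>s t. t \<in> I \<Longrightarrow> outer_faces_zero M s (Q s t)"
    and solution: "\<And>s t. t \<in> I \<Longrightarrow> solves_at M s I (Q s) (X t) t"
  shows "\<forall>t\<in>I.
     ((\<lambda>\<tau>. energy M Minus (Q Minus \<tau>) + energy M Plus (Q Plus \<tau>)) has_real_derivative
        Fluc M Minus (Q Minus t) (X t) + Fluc M Plus (Q Plus t) (X t) + ITs M (X t))
        (at t within I) \<and>
     Fluc M Minus (Q Minus t) (X t) + Fluc M Plus (Q Plus t) (X t) + ITs M (X t) \<le> 0 \<and>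
     Fluc M Minus (Q Minus t) (X t) \<le> 0 \<and>
     Fluc M Plus (Q Plus t) (X t) \<le> 0 \<and>
     ITs M (X t) \<le> 0"
proof
  fix t assume t: "t \<in> I"
  note hat = hats[OF t]
  let ?q = "\<lambda>s. Q s t"
  let ?r = "\<lambda>s j k. - sg s * (vloc M s (?q s) j k \<bullet> Tloc M s (?q s) j k)
      - vloc M s (?q s) j k \<bullet> pen M s (?q s) (X t) j k
      + sg s * (Tloc M s (?q s) j k \<bullet> pen_tilde M s (?q s) (X t) j k)"
  have rate: "Iq M (?r Minus) + Iq M (?r Plus)
      = Fluc M Minus (?q Minus) (X t) + Fluc M Plus (?q Plus) (X t) + ITs M (X t)"
  proof -
    \<comment> \<open>The blocks are joined under one quadrature, since the balance at a fault point
      needs both sides at once.\<close>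
    have "Iq M (?r Minus) + Iq M (?r Plus) = Iq M (\<lambda>j k. ?r Minus j k + ?r Plus j k)"
      by (rule Iq_add[symmetric])
    also have "\<dots> = Iq M (\<lambda>j k.
        - (\<Sum>s\<in>{Minus, Plus}. \<Sum>i\<in>UNIV. 1 / imp M s j k $ i * \<bar>pen M s (?q s) (X t) j k $ i\<bar>\<^sup>2)
        - alpha (X t) j k * \<bar>Vhat (X t) j k\<bar>\<^sup>2)"
      unfolding Iq_def
    proof (intro sum.cong refl)
      fix j k assume "j \<in> {..npts M 2}" "k \<in> {..npts M 3}"
      then have jk: "j \<le> npts M 2" "k \<le> npts M 3" by auto
      show "surf M j k * (?r Minus j k + ?r Plus j k) * wt M 2 j * wt M 3 k = surf M j k *
        (- (\<Sum>s\<in>{Minus, Plus}. \<Sum>i\<in>UNIV. 1 / imp M s j k $ i * \<bar>pen M s (?q s) (X t) j k $ i\<bar>\<^sup>2)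
        - alpha (X t) j k * \<bar>Vhat (X t) j k\<bar>\<^sup>2) * wt M 2 j * wt M 3 k"
        unfolding hat_rate_balance[OF impedance[OF jk] hat[OF jk], symmetric] by simp
    qed
    also have "\<dots> = Fluc M Minus (?q Minus) (X t) + Fluc M Plus (?q Plus) (X t) + ITs M (X t)"
      unfolding Fluc_def ITs_def Iq_uminus[symmetric] Iq_add[symmetric] by simp
    finally show ?thesis .
  qed
  have F: "Fluc M s (?q s) (X t) \<le> 0" for s
    unfolding Fluc_def using impedance
    by (auto intro!: Iq_nonneg[OF sbp geometry] sum_nonneg simp: less_imp_le)
  have IT: "ITs M (X t) \<le> 0"
    unfolding ITs_def using hat_alpha_nonneg[OF friction hat]
    by (auto intro!: Iq_nonneg[OF sbp geometry])
  have "((\<lambda>\<tau>. energy M Minus (Q Minus \<tau>) + energy M Plus (Q Plus \<tau>)) has_real_derivative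
      Iq M (?r Minus) + Iq M (?r Plus)) (at t within I)"
    by (intro DERIV_add block_energy_rate sbp geometry fault material frame outer[OF t] solution[OF t])
  then show "((\<lambda>\<tau>. energy M Minus (Q Minus \<tau>) + energy M Plus (Q Plus \<tau>)) has_real_derivative
        Fluc M Minus (?q Minus) (X t) + Fluc M Plus (?q Plus) (X t) + ITs M (X t)) (at t within I) \<and>
     Fluc M Minus (?q Minus) (X t) + Fluc M Plus (?q Plus) (X t) + ITs M (X t) \<le> 0 \<and>
     Fluc M Minus (?q Minus) (X t) \<le> 0 \<and> Fluc M Plus (?q Plus) (X t) \<le> 0 \<and> ITs M (X t) \<le> 0"
    using F[of Minus] F[of Plus] IT unfolding rate by auto
qed

end
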